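(* For every $N\ge 3$ and every $\mathbb{E}\in\mathbb{R}^N$, \[ \inf_{\substack{|\Omega|=|B_1|\\ \Omega\ \text{convex}}}\ \mathcal{H}^{N-1}(\partial\Omega)+\mathcal{F}(\Omega)=-\infty . \]
   Context: The infimum runs over compact convex sets $\Omega\subset\mathbb{R}^N$ with $|\Omega|=|B_1|$, where $B_1$ is the unit ball of $\mathbb{R}^N$, $|\cdot|$ denotes Lebesgue measure and $\mathcal{H}^{N-1}$ is the $(N-1)$-dimensional Hausdorff measure. The vector $\mathbb{E}$ is a constant external electric field. For a signed measure $\mu$, \[ I_2(\mu):=\int_{\mathbb{R}^N\times\mathbb{R}^N}\frac{d\mu(x)\,d\mu(y)}{|x-y|^{N-2}} , \] and \[ \mathcal{F}(\Omega):=\min_{\mu(\Omega)=0}\left( I_2(\mu)-\int_\Omega \mathbb{E}\cdot x\,d\mu(x)\right), \] where the minimization is over signed measures $\mu$ supported on $\Omega$ with $\mu(\Omega)=0$.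
   Formalization: The formal statement assumes $\mathbb{E}\neq 0$: for $\mathbb{E}=0$ the claim is false, since $I_2\ge 0$ gives $\mathcal{F}(\Omega)=0$ and the infimum is of the perimeter, which is nonnegative. *)

theory Defs
  imports "HOL-Analysis.Analysis"
begin

section \<open>Hausdorff measure\<close>

text \<open>
  The factor \<open>unit_ball_vol k / 2 ^ k\<close> is the usual normalisation, for which the
  \<open>n\<close>-dimensional Hausdorff measure on \<open>n\<close>-dimensional Euclidean space is Lebesgue measure.
  Boundedness of the covering sets is required explicitly because \<^const>\<open>diameter\<close> carries no
  information on unbounded sets. Empty sets cost nothing; this matters only for \<open>k = 0\<close>, where
  \<open>0 ^ 0 = 1\<close>.
\<close>

definition hausdorff_pre :: "nat \<Rightarrow> real \<Rightarrow> 'a::metric_space set \<Rightarrow> ennreal" where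
  "hausdorff_pre k \<delta> A =
     (INF C \<in> {C :: nat \<Rightarrow> 'a set. A \<subseteq> (\<Union>i. C i) \<and> (\<forall>i. bounded (C i) \<and> diameter (C i) \<le> \<delta>)}.
        \<Sum>i. if C i = {} then 0 else ennreal (unit_ball_vol (real k) * (diameter (C i) / 2) ^ k))"

definition hausdorff_measure :: "nat \<Rightarrow> 'a::metric_space set \<Rightarrow> ennreal" where
  "hausdorff_measure k A = (SUP \<delta>\<in>{0<..}. hausdorff_pre k \<delta> A)"

section \<open>Finite signed Borel measures\<close>

text \<open>
  A signed measure is a real-valued countably additive function on the Borel sets; its values
  on other sets are irrelevant.
\<close>

definition signed_measure :: "('a::topological_space set \<Rightarrow> real) \<Rightarrow> bool" where
  "signed_measure \<mu> \<longleftrightarrow>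
     \<mu> {} = 0 \<and>
     (\<forall>A. range A \<subseteq> sets borel \<longrightarrow> disjoint_family A \<longrightarrow> (\<lambda>i. \<mu> (A i)) sums \<mu> (\<Union>i::nat. A i))"

text \<open>
  The parts of the Jordan decomposition, \<open>\<mu>\<^sup>+(A) = sup {\<mu>(B) | B \<subseteq> A Borel}\<close> and
  \<open>\<mu>\<^sup>- = (-\<mu>)\<^sup>+\<close>. Negative values of \<open>\<mu>\<close> are truncated to \<open>0 = \<mu>({})\<close> by \<^const>\<open>ennreal\<close>,
  which does not change the supremum.
\<close>

definition pos_part :: "('a::topological_space set \<Rightarrow> real) \<Rightarrow> 'a measure" where
  "pos_part \<mu> = measure_of UNIV (sets borel) (\<lambda>A. SUP B \<in> {B \<in> sets borel. B \<subseteq> A}. ennreal (\<mu> B))"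

definition neg_part :: "('a::topological_space set \<Rightarrow> real) \<Rightarrow> 'a measure" where
  "neg_part \<mu> = pos_part (\<lambda>A. - \<mu> A)"

definition signed_integral ::
    "'a::topological_space set \<Rightarrow> ('a set \<Rightarrow> real) \<Rightarrow> ('a \<Rightarrow> real) \<Rightarrow> real" where
  "signed_integral A \<mu> f =
     set_lebesgue_integral (pos_part \<mu>) A f - set_lebesgue_integral (neg_part \<mu>) A f"

definition supported_on :: "('a::topological_space set \<Rightarrow> real) \<Rightarrow> 'a set \<Rightarrow> bool" where
  "supported_on \<mu> \<Omega> \<longleftrightarrow> (\<forall>A\<in>sets borel. A \<inter> \<Omega> = {} \<longrightarrow> \<mu> A = 0)"

lemma sets_pos_part [simp, measurable_cong]: "sets (pos_part \<mu>) = sets borel"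
  unfolding pos_part_def using sets.sets_measure_of_eq[of borel] by (simp only: space_borel)

lemma signed_measure_sums:
  assumes "signed_measure \<mu>" "range A \<subseteq> sets borel" "disjoint_family A"
  shows "(\<lambda>i::nat. \<mu> (A i)) sums \<mu> (\<Union>i. A i)"
  using assms unfolding signed_measure_def by blast

lemma signed_measure_Un:
  assumes \<mu>: "signed_measure \<mu>" and "A \<in> sets borel" "B \<in> sets borel" "A \<inter> B = {}"
  shows "\<mu> (A \<union> B) = \<mu> A + \<mu> B"
proof -
  have "(\<lambda>i. \<mu> (binaryset A B i)) sums \<mu> (\<Union>i. binaryset A B i)"
  proof (rule signed_measure_sums[OF \<mu>])
    show "range (binaryset A B) \<subseteq> sets borel"
      using assms by (simp add: range_binaryset_eq)
    show "disjoint_family (binaryset A B)"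
      using assms(4) by (auto simp: disjoint_family_on_def binaryset_def)
  qed
  moreover have "(\<lambda>i. \<mu> (binaryset A B i)) sums (\<mu> A + \<mu> B)"
    using \<mu> by (intro binaryset_sums) (simp add: signed_measure_def)
  ultimately show ?thesis
    by (simp add: UN_binaryset_eq sums_unique2)
qed

text \<open>
  \<^const>\<open>measure_of\<close> returns the null measure when applied to a function that is not a measure;
  the next lemma shows that this does not happen in \<^const>\<open>pos_part\<close>.
\<close>

lemma emeasure_pos_part:
  assumes \<mu>: "signed_measure (\<mu> :: 'a::topological_space set \<Rightarrow> real)" and A: "A \<in> sets borel"
  shows "emeasure (pos_part \<mu>) A = (SUP B \<in> {B \<in> sets borel. B \<subseteq> A}. ennreal (\<mu> B))"
proof -
  define P where "P = (\<lambda>A. SUP B \<in> {B \<in> sets borel. B \<subseteq> A}. ennreal (\<mu> B))"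
  have upper: "ennreal (\<mu> B) \<le> P A" if "B \<in> sets borel" "B \<subseteq> A" for A B
    unfolding P_def using that by (intro SUP_upper) auto
  have mono: "P A \<le> P B" if "A \<subseteq> B" for A B
    unfolding P_def using that by (intro SUP_subset_mono) auto
  have empty: "P {} = 0"
  proof -
    have "{B \<in> sets borel. B \<subseteq> {}} = {{} :: 'a set}" by auto
    then show ?thesis using \<mu> by (simp add: P_def signed_measure_def)
  qed
  have pair: "ennreal (\<mu> B) + ennreal (\<mu> B') \<le> P (A \<union> A')"
    if "A \<inter> A' = {}" "B \<in> sets borel" "B \<subseteq> A" "B' \<in> sets borel" "B' \<subseteq> A'" for A A' B B'
  proof -
    consider "\<mu> B < 0" | "\<mu> B' < 0" | "\<mu> B \<ge> 0" "\<mu> B' \<ge> 0" by linarith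
    then show ?thesis
    proof cases
      case 1
      then show ?thesis using upper[of B' "A \<union> A'"] that by (auto simp: ennreal_neg)
    next
      case 2
      then show ?thesis using upper[of B "A \<union> A'"] that by (auto simp: ennreal_neg)
    next
      case 3
      have "\<mu> (B \<union> B') = \<mu> B + \<mu> B'" using that by (intro signed_measure_Un[OF \<mu>]) auto
      then have "ennreal (\<mu> B) + ennreal (\<mu> B') = ennreal (\<mu> (B \<union> B'))" using 3 by simp
      also have "\<dots> \<le> P (A \<union> A')" using that by (intro upper) auto
      finally show ?thesis .
    qed
  qed
  have super: "P A + P A' \<le> P (A \<union> A')" if "A \<inter> A' = {}" for A A'
  proof -
    let ?S = "\<lambda>A. {B \<in> sets borel. B \<subseteq> A}"
    have ne: "?S A \<noteq> {}" for A :: "'a set" by auto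
    have "P A + P A' = (SUP B\<in>?S A. ennreal (\<mu> B) + P A')"
      unfolding fun_cong[OF P_def, of A] using ne by (simp add: ennreal_SUP_add_left)
    also have "\<dots> \<le> P (A \<union> A')"
    proof (rule SUP_least)
      fix B assume B: "B \<in> ?S A"
      have "ennreal (\<mu> B) + P A' = (SUP B'\<in>?S A'. ennreal (\<mu> B) + ennreal (\<mu> B'))"
        unfolding P_def using ne by (simp add: ennreal_SUP_add_right)
      also have "\<dots> \<le> P (A \<union> A')"
        using B that by (intro SUP_least pair) auto
      finally show "ennreal (\<mu> B) + P A' \<le> P (A \<union> A')" .
    qed
    finally show ?thesis .
  qed
  have ca: "countably_additive (sets borel) P"
  proof (rule countably_additiveI)
    fix A :: "nat \<Rightarrow> 'a set"
    assume A: "range A \<subseteq> sets borel" "disjoint_family A" "(\<Union>i. A i) \<in> sets borel"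
    have fin: "(\<Sum>i<n. P (A i)) \<le> P (\<Union>i<n. A i)" for n
    proof (induction n)
      case (Suc n)
      have disj: "(\<Union>i<n. A i) \<inter> A n = {}"
      proof -
        have "A i \<inter> A n = {}" if "i < n" for i
          using A(2) that by (intro disjoint_family_onD[of A UNIV]) auto
        then show ?thesis by blast
      qed
      have "(\<Sum>i<Suc n. P (A i)) \<le> P (\<Union>i<n. A i) + P (A n)"
        using Suc.IH by (simp add: add_right_mono)
      also have "\<dots> \<le> P ((\<Union>i<n. A i) \<union> A n)" by (rule super[OF disj])
      also have "(\<Union>i<n. A i) \<union> A n = (\<Union>i<Suc n. A i)" by (auto simp: lessThan_Suc)
      finally show ?case .
    qed simp
    have le: "(\<Sum>i. P (A i)) \<le> P (\<Union>i. A i)"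
    proof (rule suminf_le_const)
      fix n
      show "(\<Sum>i<n. P (A i)) \<le> P (\<Union>i. A i)"
        by (rule order_trans[OF fin]) (auto intro!: mono)
    qed simp
    have ge: "P (\<Union>i. A i) \<le> (\<Sum>i. P (A i))"
      unfolding fun_cong[OF P_def, of "\<Union>i. A i"]
    proof (rule SUP_least)
      fix B assume "B \<in> {B \<in> sets borel. B \<subseteq> (\<Union>i. A i)}"
      then have B: "B \<in> sets borel" "(\<Union>i. B \<inter> A i) = B" by blast+
      have "(\<lambda>i. \<mu> (B \<inter> A i)) sums \<mu> (\<Union>i. B \<inter> A i)"
      proof (intro signed_measure_sums[OF \<mu>])
        show "range (\<lambda>i. B \<inter> A i) \<subseteq> sets borel" using A(1) B(1) by blast
        show "disjoint_family (\<lambda>i. B \<inter> A i)"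
          using A(2) unfolding disjoint_family_on_def by blast
      qed
      then have "(\<lambda>n. \<Sum>i<n. \<mu> (B \<inter> A i)) \<longlonglongrightarrow> \<mu> B"
        using B(2) by (simp add: sums_def)
      then have lim: "(\<lambda>n. ennreal (\<Sum>i<n. \<mu> (B \<inter> A i))) \<longlonglongrightarrow> ennreal (\<mu> B)"
        by (rule tendsto_ennrealI)
      show "ennreal (\<mu> B) \<le> (\<Sum>i. P (A i))"
      proof (rule LIMSEQ_le_const2[OF lim], intro exI allI impI)
        fix n :: nat
        have "ennreal (\<Sum>i<n. \<mu> (B \<inter> A i)) \<le> ennreal (\<Sum>i<n. max 0 (\<mu> (B \<inter> A i)))"
          by (intro ennreal_leI sum_mono) simp
        also have "\<dots> = (\<Sum>i<n. ennreal (max 0 (\<mu> (B \<inter> A i))))"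
          by (subst sum_ennreal) auto
        also have "\<dots> = (\<Sum>i<n. ennreal (\<mu> (B \<inter> A i)))"
          by (intro sum.cong refl) (simp add: max_def ennreal_neg)
        also have "\<dots> \<le> (\<Sum>i<n. P (A i))"
          using A(1) B(1) by (intro sum_mono upper) auto
        also have "\<dots> \<le> (\<Sum>i. P (A i))"
          by (rule sum_le_suminf) auto
        finally show "ennreal (\<Sum>i<n. \<mu> (B \<inter> A i)) \<le> (\<Sum>i. P (A i))" .
      qed
    qed
    show "(\<Sum>i. P (A i)) = P (\<Union>i. A i)"
      using le ge by (rule antisym)
  qed
  have "pos_part \<mu> = measure_of UNIV (sets borel) P"
    by (simp add: pos_part_def P_def)
  then have "emeasure (pos_part \<mu>) A = P A"
    by (rule emeasure_measure_of) (use empty ca A in \<open>simp_all add: positive_def\<close>)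
  then show ?thesis by (simp only: P_def)
qed

section \<open>The energy functionals\<close>

text \<open>
  The kernel is \<open>|x - y| ^ (2 - N)\<close> with value \<open>\<infinity>\<close> on the diagonal, so that atoms have
  infinite self-energy; hence the division is carried out in \<^typ>\<open>ennreal\<close>.
\<close>

definition mutual_energy :: "(real ^ 'n) measure \<Rightarrow> (real ^ 'n) measure \<Rightarrow> ennreal" where
  "mutual_energy M M' =
     (\<integral>\<^sup>+ (x, y). 1 / ennreal (norm (x - y) ^ (CARD('n) - 2)) \<partial>(M \<Otimes>\<^sub>M M'))"

text \<open>
  The positive part of \<open>\<mu> \<otimes> \<mu>\<close> is \<open>\<mu>\<^sup>+ \<otimes> \<mu>\<^sup>+ + \<mu>\<^sup>- \<otimes> \<mu>\<^sup>-\<close>, its negative part is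
  \<open>\<mu>\<^sup>+ \<otimes> \<mu>\<^sup>- + \<mu>\<^sup>- \<otimes> \<mu>\<^sup>+\<close>. In \<^typ>\<open>ereal\<close> one has \<open>\<infinity> - \<infinity> = \<infinity>\<close>: a signed measure for which
  the double integral is undefined gets energy \<open>\<infinity>\<close> and does not compete in the minimisation.
\<close>

definition I2 :: "((real ^ 'n) set \<Rightarrow> real) \<Rightarrow> ereal" where
  "I2 \<mu> =
     enn2ereal (mutual_energy (pos_part \<mu>) (pos_part \<mu>) + mutual_energy (neg_part \<mu>) (neg_part \<mu>)) -
     enn2ereal (mutual_energy (pos_part \<mu>) (neg_part \<mu>) + mutual_energy (neg_part \<mu>) (pos_part \<mu>))"

text \<open>
  The minimum over neutral signed measures is written as an infimum. For \<open>E = 0\<close> it is \<open>0\<close>,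
  attained at the null measure, because \<^const>\<open>I2\<close> is nonnegative.
\<close>

definition field_energy :: "real ^ 'n \<Rightarrow> (real ^ 'n) set \<Rightarrow> ereal" where
  "field_energy E \<Omega> =
     (INF \<mu> \<in> {\<mu>. signed_measure \<mu> \<and> supported_on \<mu> \<Omega> \<and> \<mu> \<Omega> = 0}.
        I2 \<mu> - ereal (signed_integral \<Omega> \<mu> (\<lambda>x. E \<bullet> x)))"

end

theory Submission
  imports Defs "HOL-Probability.Probability_Measure"
begin

text \<open>
  Take for \<open>\<Omega>\<close> a thin box of length \<open>K s\<close> along a coordinate axis on which \<open>E\<close> does not vanish and
  of width \<open>s = 1 / t\<close> in all other directions, where \<open>K s ^ N = |B\<^sub>1|\<close>. As \<open>t \<rightarrow> \<infinity>\<close> the perimeter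
  is of order \<open>t\<close>. Putting a unit charge uniformly on the cube at one end and the opposite charge on
  the cube at the other end costs a self-energy of order \<open>t ^ (N - 2)\<close> (the interaction of the two
  charges is attractive and can be dropped), whereas the field term gains \<open>|E\<^sub>i| K s\<close>, which is of
  order \<open>t ^ (N - 1)\<close> and wins because \<open>N \<ge> 3\<close>.
\<close>

section \<open>Hausdorff premeasure and finite covers\<close>

text \<open>Empty sets are free, so a finite cover extends to a sequence without extra cost. Keeping
  the actual diameter bound \<open>d\<close> apart from the scale \<open>\<delta>\<close> lets the
  estimate depend on the pieces only.\<close>

lemma hausdorff_pre_le_finite_cover:
  fixes A :: "'a::metric_space set"
  assumes "finite I" "A \<subseteq> (\<Union>i\<in>I. D i)"
    and D: "\<And>i. i \<in> I \<Longrightarrow> bounded (D i) \<and> diameter (D i) \<le> d" and "d \<le> \<delta>" "0 \<le> d"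
  shows "hausdorff_pre k \<delta> A \<le> ennreal (real (card I) * (unit_ball_vol (real k) * (d / 2) ^ k))"
proof -
  obtain e where e: "bij_betw e {..<card I} I"
    using ex_bij_betw_nat_finite[OF \<open>finite I\<close>] by (auto simp: atLeast0LessThan)
  define C where "C = (\<lambda>m. if m < card I then D (e m) else {})"
  define f where "f = (\<lambda>m. if C m = {} then 0
    else ennreal (unit_ball_vol (real k) * (diameter (C m) / 2) ^ k))"
  have eI: "e m \<in> I" if "m < card I" for m
    using bij_betwE[OF e] that by auto
  have "A \<subseteq> (\<Union>m. C m)"
  proof
    fix x assume "x \<in> A"
    then obtain j where "j \<in> I" "x \<in> D j" using assms(2) by auto
    moreover have "e ` {..<card I} = I" using e by (rule bij_betw_imp_surj_on)
    ultimately have "j \<in> e ` {..<card I}" using \<open>j \<in> I\<close> by simp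
    then obtain m where "m < card I" "e m = j" by auto
    then show "x \<in> (\<Union>m. C m)" using \<open>x \<in> D j\<close> by (auto simp: C_def)
  qed
  moreover have "bounded (C m) \<and> diameter (C m) \<le> \<delta>" for m
    using D[OF eI[of m]] assms(4,5) by (auto simp: C_def)
  ultimately have "hausdorff_pre k \<delta> A \<le> (\<Sum>m. f m)"
    unfolding hausdorff_pre_def f_def by (intro INF_lower) auto
  \<comment> \<open>The padding terms vanish by the explicit case for empty sets, also when
    \<open>k = 0\<close>, where the power would be 1.\<close>
  also have "(\<Sum>m. f m) = (\<Sum>m<card I. f m)"
    by (rule suminf_finite) (auto simp: f_def C_def)
  also have "\<dots> \<le> (\<Sum>m<card I. ennreal (unit_ball_vol (real k) * (d / 2) ^ k))"
  proof (rule sum_mono)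
    fix m assume "m \<in> {..<card I}"
    then have "bounded (C m)" "diameter (C m) \<le> d"
      using D[OF eI[of m]] by (auto simp: C_def)
    then show "f m \<le> ennreal (unit_ball_vol (real k) * (d / 2) ^ k)"
      unfolding f_def
      by (auto intro!: ennreal_leI mult_left_mono power_mono divide_right_mono diameter_ge_0)
  qed
  also have "\<dots> = ennreal (real (card I) * (unit_ball_vol (real k) * (d / 2) ^ k))"
    using \<open>0 \<le> d\<close> by (simp add: ennreal_mult'' ennreal_of_nat_eq_real_of_nat)
  finally show ?thesis .
qed

section \<open>Riesz potential and self-energy of a uniform charge\<close>

text \<open>Dyadic shells replace polar coordinates. Where
  \<open>R / 2 ^ Suc k \<le> norm (x - y) < R / 2 ^ k\<close> the kernel is at most
  \<open>c k\<close>, and the shell lies in the ball of radius \<open>r k\<close>; the products of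
  \<open>c k\<close> with the ball volumes form a geometric series of ratio 1/4.\<close>

lemma nn_integral_Riesz_kernel_ball_le:
  fixes x :: "'a::euclidean_space"
  assumes "0 < R" "2 \<le> DIM('a)"
  shows "(\<integral>\<^sup>+ y. (1 / ennreal (norm (x - y) ^ (DIM('a) - 2))) * indicator (ball x R) y \<partial>lborel)
    \<le> ennreal (2 ^ DIM('a) * unit_ball_vol (real DIM('a)) * R\<^sup>2)"
proof -
  define n where "n = DIM('a)"
  define c where "c = (\<lambda>k::nat. (2 ^ Suc k / R) ^ (n - 2))"
  define r where "r = (\<lambda>k::nat. R / 2 ^ k)"
  define V where "V = unit_ball_vol (real n)"
  have V: "V \<ge> 0" by (simp add: V_def)
  have "(\<integral>\<^sup>+ y. (1 / ennreal (norm (x - y) ^ (n - 2))) * indicator (ball x R) y \<partial>lborel)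
    \<le> (\<integral>\<^sup>+ y. (\<Sum>k. ennreal (c k) * indicator (ball x (r k)) y) \<partial>lborel)"
  proof (rule nn_integral_mono_AE)
    \<comment> \<open>The centre lies in no shell and is discarded as a null set.\<close>
    have "AE y in lborel. y \<noteq> x" by (rule AE_lborel_singleton)
    then show "AE y in lborel. (1 / ennreal (norm (x - y) ^ (n - 2))) * indicator (ball x R) y
      \<le> (\<Sum>k. ennreal (c k) * indicator (ball x (r k)) y)"
    proof eventually_elim
      case (elim y)
      show ?case
      proof (cases "y \<in> ball x R")
        case True
        define z where "z = norm (x - y)"
        have z: "0 < z" "z < R" using elim True by (auto simp: z_def dist_norm)
        obtain k0 :: nat where "R / z < 2 ^ k0"
          using real_arch_pow[of 2 "R / z"] by auto
        then have ex: "R / 2 ^ k0 \<le> z"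
          using z by (simp add: field_simps)
        \<comment> \<open>The least such index is positive because \<open>z < R\<close>; its
          predecessor \<open>k\<close> is the index of the shell containing
          \<open>y\<close>.\<close>
        define m where "m = (LEAST k. R / 2 ^ k \<le> z)"
        have m: "R / 2 ^ m \<le> z" unfolding m_def using ex by (rule LeastI)
        have "m \<noteq> 0" using m z by (cases m) auto
        then obtain k where k: "m = Suc k" by (cases m) auto
        have "\<not> R / 2 ^ k \<le> z"
          using not_less_Least[of k "\<lambda>k. R / 2 ^ k \<le> z"] k m_def by auto
        then have yk: "y \<in> ball x (r k)" by (simp add: r_def z_def dist_norm)
        have "1 / z \<le> 2 ^ Suc k / R"
          using m k z by (simp add: field_simps)
        then have "(1 / z) ^ (n - 2) \<le> c k"
          unfolding c_def using z by (intro power_mono) auto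
        then have "1 / ennreal (z ^ (n - 2)) \<le> ennreal (c k)"
          using z divide_ennreal[of 1 "z ^ (n - 2)"] by (simp add: ennreal_leI power_one_over)
        also have "\<dots> = (\<Sum>j\<in>{k}. ennreal (c j) * indicator (ball x (r j)) y)"
          using yk by simp
        also have "\<dots> \<le> (\<Sum>j. ennreal (c j) * indicator (ball x (r j)) y)"
          by (rule sum_le_suminf) auto
        finally show ?thesis using True by (simp add: z_def)
      qed auto
    qed
  qed
  also have "\<dots> = (\<Sum>k. \<integral>\<^sup>+ y. ennreal (c k) * indicator (ball x (r k)) y \<partial>lborel)"
    by (intro nn_integral_suminf borel_measurable_times_ennreal borel_measurable_const
        borel_measurable_indicator) auto
  also have "\<dots> = (\<Sum>k. ennreal (2 ^ (n - 2) * V * R\<^sup>2 * (1 / 4) ^ k))"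
  proof (rule suminf_cong)
    fix k :: nat
    have n2: "n = (n - 2) + 2" using assms(2) by (simp add: n_def)
    have "c k * r k ^ n = (c k * r k ^ (n - 2)) * (r k)\<^sup>2"
      by (subst n2, subst power_add) simp
    also have "c k * r k ^ (n - 2) = 2 ^ (n - 2)"
      unfolding c_def r_def power_mult_distrib[symmetric] using assms(1) by simp
    also have "(r k)\<^sup>2 = R\<^sup>2 * (1 / 4) ^ k"
      by (simp add: r_def power_divide power_one_over power2_eq_square power_mult_distrib[symmetric])
    finally have *: "c k * (V * r k ^ n) = 2 ^ (n - 2) * V * R\<^sup>2 * (1 / 4) ^ k"
      by (simp add: algebra_simps)
    have "(\<integral>\<^sup>+ y. ennreal (c k) * indicator (ball x (r k)) y \<partial>lborel)
      = ennreal (c k) * ennreal (V * r k ^ n)"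
      using assms(1) by (simp add: nn_integral_cmult_indicator emeasure_ball r_def V_def n_def)
    also have "\<dots> = ennreal (2 ^ (n - 2) * V * R\<^sup>2 * (1 / 4) ^ k)"
      using assms(1) V by (subst ennreal_mult[symmetric]) (simp_all add: * , simp_all add: c_def r_def)
    finally show "(\<integral>\<^sup>+ y. ennreal (c k) * indicator (ball x (r k)) y \<partial>lborel) = \<dots>" .
  qed
  also have "\<dots> = ennreal (\<Sum>k. 2 ^ (n - 2) * V * R\<^sup>2 * (1 / 4) ^ k)"
    using V by (intro suminf_ennreal2 summable_mult summable_geometric) auto
  also have "(\<Sum>k. 2 ^ (n - 2) * V * R\<^sup>2 * (1 / 4) ^ k) = 2 ^ (n - 2) * V * R\<^sup>2 * (4 / 3)"
    by (subst suminf_mult) (auto simp: suminf_geometric)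
  \<comment> \<open>The value 4/3 of the series is relaxed to 4, which turns
    \<open>2 ^ (n - 2)\<close> into \<open>2 ^ n\<close>.\<close>
  also have "ennreal \<dots> \<le> ennreal (2 ^ n * V * R\<^sup>2)"
  proof (rule ennreal_leI)
    have "n = (n - 2) + 2" using assms(2) by (simp add: n_def)
    then have "(2::real) ^ n = 2 ^ (n - 2) * 2\<^sup>2" by (metis power_add)
    then show "2 ^ (n - 2) * V * R\<^sup>2 * (4 / 3) \<le> 2 ^ n * V * R\<^sup>2"
      using V by (simp add: mult_right_mono)
  qed
  finally show ?thesis by (simp add: n_def V_def)
qed

text \<open>From any \<open>x\<close> in \<open>S\<close> the whole of \<open>S\<close> lies in
  \<open>ball x R\<close>, so the potential at \<open>x\<close> is at most the kernel integral over
  that ball divided by \<open>v\<close>. Integrating this against a probability measure preserves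
  the bound.\<close>

lemma mutual_energy_uniform_le:
  fixes S :: "(real ^ 'n) set"
  assumes S: "S \<in> sets borel" and v: "emeasure lborel S = ennreal v" "0 < v"
    and R: "0 < R" "\<And>x y. x \<in> S \<Longrightarrow> y \<in> S \<Longrightarrow> dist x y < R"
    and N: "2 \<le> CARD('n)"
  shows "mutual_energy (uniform_measure lborel S) (uniform_measure lborel S)
    \<le> ennreal (2 ^ CARD('n) * unit_ball_vol (real CARD('n)) * R\<^sup>2 / v)"
proof -
  let ?P = "uniform_measure lborel S"
  let ?k = "\<lambda>x y. 1 / ennreal (norm (x - y :: real ^ 'n) ^ (CARD('n) - 2))"
  define C where "C = 2 ^ CARD('n) * unit_ball_vol (real CARD('n)) * R\<^sup>2"
  have C: "C \<ge> 0" by (simp add: C_def)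
  interpret P: prob_space ?P
    using v by (intro prob_space_uniform_measure) auto
  have "mutual_energy ?P ?P = (\<integral>\<^sup>+ z. (case z of (x, y) \<Rightarrow> ?k x y) \<partial>(?P \<Otimes>\<^sub>M ?P))"
    by (simp add: mutual_energy_def)
  also have "\<dots> = (\<integral>\<^sup>+ x. \<integral>\<^sup>+ y. ?k x y \<partial>?P \<partial>?P)"
    by (subst P.nn_integral_fst[symmetric]) (auto simp: measurable_split_conv)
  also have "\<dots> \<le> (\<integral>\<^sup>+ x. ennreal (C / v) \<partial>?P)"
  proof (rule nn_integral_mono_AE)
    have "AE x in ?P. x \<in> S" using v S by (auto intro!: AE_uniform_measureI)
    then show "AE x in ?P. (\<integral>\<^sup>+ y. ?k x y \<partial>?P) \<le> ennreal (C / v)"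
    proof eventually_elim
      case (elim x)
      have "(\<integral>\<^sup>+ y. ?k x y \<partial>?P) = (\<integral>\<^sup>+ y. ?k x y * indicator S y \<partial>lborel) / ennreal v"
        using S v by (subst nn_integral_uniform_measure) auto
      also have "\<dots> \<le> (\<integral>\<^sup>+ y. ?k x y * indicator (ball x R) y \<partial>lborel) / ennreal v"
        using R(2)[OF elim]
        by (intro divide_right_mono_ennreal nn_integral_mono mult_left_mono) (auto simp: indicator_def)
      also have "\<dots> \<le> ennreal C / ennreal v"
        using nn_integral_Riesz_kernel_ball_le[OF R(1), of x] N
        by (intro divide_right_mono_ennreal) (simp add: C_def)
      also have "\<dots> = ennreal (C / v)" using C v by (simp add: divide_ennreal)
      finally show ?case .
    qed
  qed
  also have "\<dots> = ennreal (C / v)" using P.emeasure_space_1 by simp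
  finally show ?thesis by (simp add: C_def)
qed

section \<open>Jordan decomposition and the two-charge competitor\<close>

lemma signed_measure_diff_measures:
  assumes "finite_measure M" "finite_measure M'" "sets M = sets borel" "sets M' = sets borel"
  shows "signed_measure (\<lambda>A. measure M A - measure M' A)"
  unfolding signed_measure_def using assms
  by (auto intro!: sums_diff finite_measure.finite_measure_UNION)

text \<open>\<open>S\<close> is a Hahn set for the difference: \<open>M\<close> lives on
  \<open>S\<close> and \<open>M'\<close> off it. The supremum defining the positive part is
  therefore attained at \<open>A \<inter> S\<close>.\<close>

lemma pos_part_diff_measures:
  assumes M: "finite_measure M" and M': "finite_measure M'"
    and sM: "sets M = sets borel" and sM': "sets M' = sets borel"
    and S: "S \<in> sets borel" "emeasure M (- S) = 0" "emeasure M' S = 0"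
  shows "pos_part (\<lambda>A. measure M A - measure M' A) = M"
proof (rule measure_eqI)
  show "sets (pos_part (\<lambda>A. measure M A - measure M' A)) = sets M" by (simp add: sM)
next
  interpret M: finite_measure M by fact
  interpret M': finite_measure M' by fact
  fix A assume "A \<in> sets (pos_part (\<lambda>A. measure M A - measure M' A))"
  then have A: "A \<in> sets borel" by simp
  have "(SUP B\<in>{B \<in> sets borel. B \<subseteq> A}. ennreal (measure M B - measure M' B)) = emeasure M A"
  proof (rule antisym)
    show "(SUP B\<in>{B \<in> sets borel. B \<subseteq> A}. ennreal (measure M B - measure M' B)) \<le> emeasure M A"
    proof (rule SUP_least)
      fix B assume B: "B \<in> {B \<in> sets borel. B \<subseteq> A}"
      have "ennreal (measure M B - measure M' B) \<le> ennreal (measure M B)"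
        by (rule ennreal_leI) simp
      also have "\<dots> = emeasure M B" by (simp add: M.emeasure_eq_measure)
      also have "\<dots> \<le> emeasure M A" using B A sM by (intro emeasure_mono) auto
      finally show "ennreal (measure M B - measure M' B) \<le> emeasure M A" .
    qed
    have "emeasure M' (A \<inter> S) \<le> emeasure M' S" using S sM' by (intro emeasure_mono) auto
    then have 0: "measure M' (A \<inter> S) = 0" using S(3) by (simp add: measure_def)
    have "emeasure M A = emeasure M ((A \<inter> S) \<union> (A \<inter> - S))" by (rule arg_cong[of _ _ "emeasure M"]) auto
    also have "\<dots> \<le> emeasure M (A \<inter> S) + emeasure M (A \<inter> - S)"
      using A S sM by (intro emeasure_subadditive) auto
    also have "emeasure M (A \<inter> - S) \<le> emeasure M (- S)"
      using S A sM by (intro emeasure_mono) auto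
    also have "\<dots> = 0" by fact
    finally have "emeasure M A \<le> ennreal (measure M (A \<inter> S) - measure M' (A \<inter> S))"
      using 0 by (simp add: M.emeasure_eq_measure)
    also have "\<dots> \<le> (SUP B\<in>{B \<in> sets borel. B \<subseteq> A}. ennreal (measure M B - measure M' B))"
      using A S by (intro SUP_upper) auto
    finally show "emeasure M A \<le> \<dots>" .
  qed
  then show "emeasure (pos_part (\<lambda>A. measure M A - measure M' A)) A = emeasure M A"
    by (subst emeasure_pos_part[OF signed_measure_diff_measures[OF M M' sM sM'] A])
qed

text \<open>The competitor is the uniform probability on \<open>S\<close> minus that on
  \<open>T\<close>. Its Jordan parts are these two measures, so only their self-energies and the
  field term have to be estimated.\<close>

lemma field_energy_le_two_uniform_charges:
  fixes E :: "real ^ 'n" and S T \<Omega> :: "(real ^ 'n) set"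
  assumes borel: "S \<in> sets borel" "T \<in> sets borel" "\<Omega> \<in> sets borel"
    and sub: "S \<inter> T = {}" "S \<subseteq> \<Omega>" "T \<subseteq> \<Omega>" "bounded \<Omega>"
    and v: "emeasure lborel S = ennreal v" "emeasure lborel T = ennreal v" "0 < v"
    and R: "0 < R" "\<And>x y. x \<in> S \<Longrightarrow> y \<in> S \<Longrightarrow> dist x y < R"
      "\<And>x y. x \<in> T \<Longrightarrow> y \<in> T \<Longrightarrow> dist x y < R"
    and E: "\<And>x. x \<in> S \<Longrightarrow> \<alpha> \<le> E \<bullet> x" "\<And>x. x \<in> T \<Longrightarrow> E \<bullet> x \<le> \<beta>"
    and N: "2 \<le> CARD('n)"
  shows "field_energy E \<Omega> \<le>
    ereal (2 * (2 ^ CARD('n) * unit_ball_vol (real CARD('n)) * R\<^sup>2 / v) - (\<alpha> - \<beta>))"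
proof -
  let ?P = "uniform_measure lborel S" and ?Q = "uniform_measure lborel T"
  define \<mu> where "\<mu> = (\<lambda>A. measure ?P A - measure ?Q A)"
  define C where "C = 2 ^ CARD('n) * unit_ball_vol (real CARD('n)) * R\<^sup>2 / v"
  interpret P: prob_space ?P
    using v by (intro prob_space_uniform_measure) auto
  interpret Q: prob_space ?Q
    using v by (intro prob_space_uniform_measure) auto
  have fin: "finite_measure ?P" "finite_measure ?Q" by unfold_locales
  have null: "emeasure ?P (- S) = 0" "emeasure ?Q (- T) = 0" "emeasure ?Q S = 0" "emeasure ?P T = 0"
    using borel sub(1) by (simp_all add: Int_commute)
  have \<mu>': "(\<lambda>A. - \<mu> A) = (\<lambda>A. measure ?Q A - measure ?P A)" by (auto simp: \<mu>_def)
  have pos: "pos_part \<mu> = ?P"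
    unfolding \<mu>_def using borel null fin by (intro pos_part_diff_measures[of _ _ S]) auto
  \<comment> \<open>Negating the charge exchanges the roles of the two sets, so \<open>T\<close> is
    now the Hahn set.\<close>
  have neg: "neg_part \<mu> = ?Q"
    unfolding neg_part_def \<mu>' using borel null fin by (intro pos_part_diff_measures[of _ _ T]) auto
  have aeP: "AE x in ?P. x \<in> S" and aeQ: "AE x in ?Q. x \<in> T"
    using v borel by (auto intro!: AE_uniform_measureI)
  \<comment> \<open>Boundedness of \<open>\<Omega>\<close> gives integrability of the field
    potential; without it the Bochner integral would default to 0 and the bounds by constants could
    fail.\<close>
  obtain B where B: "\<And>x. x \<in> \<Omega> \<Longrightarrow> norm x \<le> B"
    using sub(4) by (auto simp: bounded_iff)
  have bd: "norm (indicator \<Omega> x *\<^sub>R (E \<bullet> x)) \<le> norm E * B" if "x \<in> \<Omega>" for x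
  proof -
    have "\<bar>E \<bullet> x\<bar> \<le> norm E * norm x" by (rule Cauchy_Schwarz_ineq2)
    also have "\<dots> \<le> norm E * B" using B[OF that] by (rule mult_left_mono) simp
    finally show ?thesis using that by simp
  qed
  have meas: "(\<lambda>x. indicator \<Omega> x *\<^sub>R (E \<bullet> x)) \<in> borel_measurable borel"
    using borel by measurable
  have "\<alpha> \<le> integral\<^sup>L ?P (\<lambda>x. indicator \<Omega> x *\<^sub>R (E \<bullet> x))"
  proof (rule P.integral_ge_const)
    show "integrable ?P (\<lambda>x. indicator \<Omega> x *\<^sub>R (E \<bullet> x))"
    proof (rule P.integrable_const_bound)
      show "AE x in ?P. norm (indicator \<Omega> x *\<^sub>R (E \<bullet> x)) \<le> norm E * B"
        using aeP by eventually_elim (use sub in \<open>intro bd, auto\<close>)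
    qed (use meas in simp)
    show "AE x in ?P. \<alpha> \<le> indicator \<Omega> x *\<^sub>R (E \<bullet> x)"
      using aeP by eventually_elim (use E sub in auto)
  qed
  moreover have "integral\<^sup>L ?Q (\<lambda>x. indicator \<Omega> x *\<^sub>R (E \<bullet> x)) \<le> \<beta>"
  proof (rule Q.integral_le_const)
    show "integrable ?Q (\<lambda>x. indicator \<Omega> x *\<^sub>R (E \<bullet> x))"
    proof (rule Q.integrable_const_bound)
      show "AE x in ?Q. norm (indicator \<Omega> x *\<^sub>R (E \<bullet> x)) \<le> norm E * B"
        using aeQ by eventually_elim (use sub in \<open>intro bd, auto\<close>)
    qed (use meas in simp)
    show "AE x in ?Q. indicator \<Omega> x *\<^sub>R (E \<bullet> x) \<le> \<beta>"
      using aeQ by eventually_elim (use E sub in auto)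
  qed
  ultimately have int: "signed_integral \<Omega> \<mu> (\<lambda>x. E \<bullet> x) \<ge> \<alpha> - \<beta>"
    by (simp add: signed_integral_def pos neg set_lebesgue_integral_def)
  have C: "C \<ge> 0" using v by (simp add: C_def)
  have "mutual_energy ?P ?P \<le> ennreal C" "mutual_energy ?Q ?Q \<le> ennreal C"
    unfolding C_def using borel v R N by (auto intro!: mutual_energy_uniform_le)
  then have "mutual_energy ?P ?P + mutual_energy ?Q ?Q \<le> ennreal C + ennreal C"
    by (rule add_mono)
  also have "\<dots> = ennreal (2 * C)" using C by (simp flip: ennreal_plus)
  finally have "enn2ereal (mutual_energy ?P ?P + mutual_energy ?Q ?Q) \<le> enn2ereal (ennreal (2 * C))"
    by (simp add: less_eq_ennreal.rep_eq)
  then have self: "enn2ereal (mutual_energy ?P ?P + mutual_energy ?Q ?Q) \<le> ereal (2 * C)"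
    using C by simp
  \<comment> \<open>The cross terms enter with a minus sign and are nonnegative, so replacing them
    by 0 only increases the energy.\<close>
  have "I2 \<mu> \<le> ereal (2 * C) - 0"
    unfolding I2_def pos neg by (intro ereal_minus_mono self) simp
  then have "I2 \<mu> - ereal (signed_integral \<Omega> \<mu> (\<lambda>x. E \<bullet> x)) \<le> ereal (2 * C) - ereal (\<alpha> - \<beta>)"
    using int by (intro ereal_minus_mono) auto
  moreover have "supported_on \<mu> \<Omega>"
    unfolding supported_on_def
  proof (intro ballI impI)
    fix A :: "(real ^ 'n) set" assume A: "A \<in> sets borel" "A \<inter> \<Omega> = {}"
    then have "S \<inter> A = {}" "T \<inter> A = {}" using sub by auto
    then show "\<mu> A = 0" using A borel by (simp add: \<mu>_def measure_def)
  qed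
  moreover have "signed_measure \<mu>"
    unfolding \<mu>_def using fin by (intro signed_measure_diff_measures) auto
  moreover have "\<mu> \<Omega> = 0"
  proof -
    have "measure ?P \<Omega> = 1"
      using aeP sub borel by (subst P.prob_eq_1) auto
    moreover have "measure ?Q \<Omega> = 1"
      using aeQ sub borel by (subst Q.prob_eq_1) auto
    ultimately show ?thesis by (simp add: \<mu>_def)
  qed
  ultimately show ?thesis
    unfolding field_energy_def C_def[symmetric]
    by (intro INF_lower2[of \<mu>]) auto
qed

section \<open>Perimeter of a thin box\<close>

text \<open>The number of grid cells on the faces is of order \<open>K * M ^ (n - 1)\<close>, while
  each cell costs a multiple of \<open>(s / M) ^ (n - 1)\<close>. The refinement \<open>M\<close>
  cancels, leaving a bound uniform in \<open>\<delta>\<close>.\<close>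

lemma hausdorff_measure_frontier_box_le:
  fixes i :: "'n::finite" and s :: real and K :: nat
  defines "b \<equiv> (\<chi> j. if j = i then real K * s else s) :: real ^ 'n"
  assumes "0 < s" "1 \<le> K"
  shows "hausdorff_measure (CARD('n) - 1) (frontier (cbox 0 b))
    \<le> ennreal (2 * real CARD('n) * real K * unit_ball_vol (real (CARD('n) - 1))
        * (real CARD('n) * s) ^ (CARD('n) - 1))"
  unfolding hausdorff_measure_def
proof (rule SUP_least)
  fix \<delta> :: real assume "\<delta> \<in> {0<..}"
  then have \<delta>: "0 < \<delta>" by simp
  define n where "n = CARD('n)"
  define V where "V = unit_ball_vol (real (n - 1))"
  have "0 < n" by (simp add: n_def)
  \<comment> \<open>\<open>M\<close> is large enough that cells of side \<open>s / M\<close> have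
    diameter at most \<open>\<delta>\<close>.\<close>
  obtain M :: nat where "real n * s / \<delta> < real M" using reals_Archimedean2 by blast
  have "0 < real n * s / \<delta>" using \<delta> assms \<open>0 < n\<close> by simp
  have M: "0 < M" "real n * (s / real M) \<le> \<delta>"
  proof -
    show "0 < M"
      using \<open>0 < real n * s / \<delta>\<close> \<open>real n * s / \<delta> < real M\<close> by (metis less_trans of_nat_0_less_iff)
    then show "real n * (s / real M) \<le> \<delta>"
      using \<open>real n * s / \<delta> < real M\<close> \<delta> by (simp add: field_simps)
  qed
  define h where "h = s / real M"
  have h: "0 < h" "real M * h = s" using assms M by (auto simp: h_def)
  txt \<open>The faces are cut into \<open>(N - 1)\<close>-dimensional cubes of side \<open>h\<close>: \<open>j\<close> is the normal direction of
    the face, \<open>u\<close> selects one of the two faces normal to it, and \<open>m\<close> is the grid position.\<close>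
  define D where "D = (\<lambda>(j, u, m :: 'n \<Rightarrow> nat).
    {x :: real ^ 'n. x $ j = (if u then b $ j else 0)
      \<and> (\<forall>l. l \<noteq> j \<longrightarrow> real (m l) * h \<le> x $ l \<and> x $ l \<le> (real (m l) + 1) * h)})"
  \<comment> \<open>The normal coordinate carries the dummy index 0. The other ranges include their
    upper end, since the floor reaches it when \<open>x $ l = b $ l\<close>; the extra cell sticks
    out of the box harmlessly.\<close>
  define F where "F = (\<lambda>j l. if l = j then {0::nat} else {..if l = i then K * M else M})"
  define I where "I = (SIGMA j:UNIV. (UNIV :: bool set) \<times> PiE UNIV (F j))"
  have finF: "finite (PiE UNIV (F j))" for j
    by (intro finite_PiE) (auto simp: F_def)
  have "finite I" unfolding I_def using finF by (intro finite_SigmaI finite_cartesian_product) auto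
  have cF: "card (PiE UNIV (F j)) \<le> K * (2 * M) ^ (n - 1)" for j
  proof -
    have "card (PiE UNIV (F j)) = (\<Prod>l\<in>UNIV. card (F j l))" by (simp add: card_PiE)
    also have "\<dots> = (\<Prod>l\<in>UNIV - {j}. card (F j l))"
      by (subst prod.remove[of UNIV j]) (auto simp: F_def)
    \<comment> \<open>The inclusive ranges have \<open>M + 1\<close> or \<open>K * M + 1\<close>
      elements, at most twice \<open>M\<close> or \<open>K * M\<close>.\<close>
    also have "\<dots> \<le> (\<Prod>l\<in>UNIV - {j}. (if l = i then K else 1) * (2 * M))"
    proof (rule prod_mono, intro conjI)
      fix l assume "l \<in> UNIV - {j}"
      have "1 \<le> K * M" using M assms by simp
      then show "card (F j l) \<le> (if l = i then K else 1) * (2 * M)"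
        using M \<open>l \<in> UNIV - {j}\<close> by (auto simp: F_def)
    qed simp
    also have "\<dots> = (\<Prod>l\<in>UNIV - {j}. if l = i then K else 1) * (2 * M) ^ (n - 1)"
      by (simp add: prod.distrib n_def card_Diff_singleton)
    \<comment> \<open>The product is \<open>K\<close> on faces containing the long direction and 1
      on the two end faces; \<open>1 \<le> K\<close> covers both.\<close>
    also have "\<dots> \<le> K * (2 * M) ^ (n - 1)"
      using assms by (intro mult_right_mono) (auto simp: prod.delta)
    finally show ?thesis .
  qed
  have "card I = (\<Sum>j\<in>UNIV. card ((UNIV :: bool set) \<times> PiE UNIV (F j)))"
    unfolding I_def using finF by (intro card_SigmaI) auto
  also have "\<dots> \<le> (\<Sum>j\<in>(UNIV :: 'n set). 2 * (K * (2 * M) ^ (n - 1)))"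
    using cF by (intro sum_mono) (simp add: card_cartesian_product)
  also have "\<dots> = 2 * n * K * (2 * M) ^ (n - 1)" by (simp add: n_def)
  finally have cI: "card I \<le> 2 * n * K * (2 * M) ^ (n - 1)" .
  have bl: "b $ l = real (if l = i then K * M else M) * h" for l
    using h by (simp add: b_def)
  have "frontier (cbox 0 b) \<subseteq> (\<Union>p\<in>I. D p)"
  proof
    fix x assume "x \<in> frontier (cbox 0 b)"
    then have x: "x \<in> cbox 0 b" "x \<notin> box 0 b" by (auto simp: frontier_cbox)
    then have xl: "0 \<le> x $ l" "x $ l \<le> b $ l" for l by (auto simp: mem_box_cart)
    from x(2) obtain j where "\<not> (0 < x $ j \<and> x $ j < b $ j)" by (auto simp: mem_box_cart)
    with xl[of j] have j: "x $ j = 0 \<or> x $ j = b $ j" by auto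
    define m where "m = (\<lambda>l. if l = j then 0 else nat \<lfloor>x $ l / h\<rfloor>)"
    have m1: "real (m l) * h \<le> x $ l" "x $ l \<le> (real (m l) + 1) * h" if "l \<noteq> j" for l
    proof -
      have "0 \<le> x $ l / h" using xl h by simp
      then have "real (m l) \<le> x $ l / h" "x $ l / h \<le> real (m l) + 1"
        using that by (simp_all add: m_def)
      then show "real (m l) * h \<le> x $ l" "x $ l \<le> (real (m l) + 1) * h"
        using h by (simp_all add: field_simps)
    qed
    have "m l \<in> F j l" for l
    proof (cases "l = j")
      case False
      have "real (m l) * h \<le> real (if l = i then K * M else M) * h"
        using m1(1)[OF False] xl(2)[of l] bl[of l] by linarith
      then have "m l \<le> (if l = i then K * M else M)"
        using h(1) mult_le_cancel_right_pos of_nat_le_iff by blast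
      then show ?thesis using False by (simp add: F_def)
    qed (simp add: F_def m_def)
    \<comment> \<open>The Boolean \<open>x $ j \<noteq> 0\<close> selects the face: a nonzero
      coordinate must equal \<open>b $ j\<close>.\<close>
    then have "(j, x $ j \<noteq> 0, m) \<in> I" by (auto simp: I_def)
    moreover have "x \<in> D (j, x $ j \<noteq> 0, m)" using j m1 by (auto simp: D_def)
    ultimately show "x \<in> (\<Union>p\<in>I. D p)" by blast
  qed
  moreover have "bounded (D p) \<and> diameter (D p) \<le> real n * h" for p
  proof -
    obtain j u m where p: "p = (j, u, m)" by (cases p) auto
    have nm: "norm (x - y) \<le> real n * h" if "x \<in> D p" "y \<in> D p" for x y
    proof -
      have "\<bar>(x - y) $ l\<bar> \<le> h" for l
      proof (cases "l = j")
        case False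
        then have "real (m l) * h \<le> x $ l" "x $ l \<le> real (m l) * h + h"
           "real (m l) * h \<le> y $ l" "y $ l \<le> real (m l) * h + h"
          using that by (auto simp: p D_def algebra_simps)
        then show ?thesis by simp
      qed (use that h in \<open>auto simp: p D_def\<close>)
      then have "(\<Sum>l\<in>UNIV. \<bar>(x - y) $ l\<bar>) \<le> real n * h"
        unfolding n_def by (intro sum_bounded_above) auto
      then show ?thesis using norm_le_l1_cart[of "x - y"] by linarith
    qed
    then have "bounded (D p)" unfolding bounded_two_points by (auto simp: dist_norm)
    moreover have "diameter (D p) \<le> real n * h"
      using nm h by (intro diameter_le) auto
    ultimately show ?thesis by simp
  qed
  ultimately have "hausdorff_pre (n - 1) \<delta> (frontier (cbox 0 b))
    \<le> ennreal (real (card I) * (V * (real n * h / 2) ^ (n - 1)))"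
    unfolding V_def using \<open>finite I\<close> M(2) h(1)
    by (intro hausdorff_pre_le_finite_cover[where D = D]) (simp_all flip: h_def)
  also have "\<dots> \<le> ennreal (real (2 * n * K * (2 * M) ^ (n - 1)) * (V * (real n * h / 2) ^ (n - 1)))"
    using cI h by (intro ennreal_leI mult_right_mono of_nat_mono) (auto simp: V_def)
  also have "real (2 * n * K * (2 * M) ^ (n - 1)) * (V * (real n * h / 2) ^ (n - 1))
    = 2 * real n * real K * V * ((2 * real M) ^ (n - 1) * (real n * h / 2) ^ (n - 1))"
    by simp
  \<comment> \<open>Here \<open>M\<close> disappears: \<open>2 * M\<close> times
    \<open>n * h / 2\<close> is \<open>n * s\<close>.\<close>
  also have "(2 * real M) ^ (n - 1) * (real n * h / 2) ^ (n - 1) = (real n * s) ^ (n - 1)"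
    unfolding power_mult_distrib[symmetric] h(2)[symmetric] by (simp add: mult.commute mult.left_commute)
  finally show "hausdorff_pre (CARD('n) - 1) \<delta> (frontier (cbox 0 b))
    \<le> ennreal (2 * real CARD('n) * real K * unit_ball_vol (real (CARD('n) - 1))
        * (real CARD('n) * s) ^ (CARD('n) - 1))"
    by (simp add: n_def V_def)
qed

section \<open>Charges on two cubes inside a box\<close>

lemma norm_diff_cube_le:
  fixes a x y :: "real ^ 'n"
  assumes "x \<in> cbox a (a + (\<chi> j. s))" "y \<in> cbox a (a + (\<chi> j. s))"
  shows "norm (x - y) \<le> real CARD('n) * s"
proof -
  have "\<bar>(x - y) $ l\<bar> \<le> s" for l
    using assms by (auto simp: mem_box_cart abs_le_iff dest!: spec[of _ l])
  then have "(\<Sum>l\<in>UNIV. \<bar>(x - y) $ l\<bar>) \<le> real CARD('n) * s"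
    by (intro sum_bounded_above) auto
  then show ?thesis using norm_le_l1_cart[of "x - y"] by linarith
qed

lemma emeasure_lborel_cbox_cart:
  fixes a b :: "real ^ 'n"
  assumes "\<And>j. a $ j \<le> b $ j"
  shows "emeasure lborel (cbox a b) = ennreal (\<Prod>j\<in>UNIV. b $ j - a $ j)"
proof -
  have "a \<in> cbox a b" using assms by (simp add: mem_box_cart)
  then have "cbox a b \<noteq> {}" by blast
  then have "measure lborel (cbox a b) = (\<Prod>j\<in>UNIV. b $ j - a $ j)"
    using content_cbox_cart[of a b] by simp
  moreover have "emeasure lborel (cbox a b) \<noteq> top"
    using emeasure_lborel_cbox_finite[of a b] by auto
  ultimately show ?thesis by (simp add: emeasure_eq_ennreal_measure)
qed

text \<open>On each cube the potential \<open>E \<bullet> x\<close> differs from its value at the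
  corner by at most \<open>d\<close>, so both charges may be treated as sitting at the corners
  \<open>a\<close> and \<open>c\<close> at a total loss of \<open>2 * d\<close>.\<close>

lemma field_energy_le_two_cubes:
  fixes E a c :: "real ^ 'n"
  assumes "0 < s" "2 \<le> CARD('n)"
    and disj: "cbox a (a + (\<chi> j. s)) \<inter> cbox c (c + (\<chi> j. s)) = {}"
    and sub: "cbox a (a + (\<chi> j. s)) \<subseteq> cbox p q" "cbox c (c + (\<chi> j. s)) \<subseteq> cbox p q"
  shows "field_energy E (cbox p q) \<le>
    ereal (2 * (2 ^ CARD('n) * unit_ball_vol (real CARD('n)) * (2 * real CARD('n) * s)\<^sup>2 / s ^ CARD('n))
      - (E \<bullet> (a - c) - 2 * norm E * (real CARD('n) * s)))"
proof -
  let ?Q = "\<lambda>a. cbox a (a + (\<chi> j. s)) :: (real ^ 'n) set"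
  define d where "d = norm E * (real CARD('n) * s)"
  have E: "\<bar>E \<bullet> (x - a)\<bar> \<le> d" if "x \<in> ?Q a" for x a
  proof -
    have "a \<in> ?Q a" using assms(1) by (auto simp: mem_box_cart)
    then have "norm (x - a) \<le> real CARD('n) * s" using that by (intro norm_diff_cube_le)
    then have "norm E * norm (x - a) \<le> d" unfolding d_def by (rule mult_left_mono) simp
    then show ?thesis using Cauchy_Schwarz_ineq2[of E "x - a"] by linarith
  qed
  \<comment> \<open>Doubling the diameter bound makes the inequality strict, as the open ball in the
    potential estimate demands.\<close>
  have dst: "dist x y < 2 * real CARD('n) * s" if "x \<in> ?Q a" "y \<in> ?Q a" for x y a
  proof -
    have "0 < real CARD('n) * s" using assms(1) by simp
    then show ?thesis using norm_diff_cube_le[OF that] by (simp add: dist_norm)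
  qed
  have "field_energy E (cbox p q) \<le>
    ereal (2 * (2 ^ CARD('n) * unit_ball_vol (real CARD('n)) * (2 * real CARD('n) * s)\<^sup>2 / s ^ CARD('n))
      - ((E \<bullet> a - d) - (E \<bullet> c + d)))"
  proof (rule field_energy_le_two_uniform_charges[where S = "?Q a" and T = "?Q c"])
    show "emeasure lborel (?Q a) = ennreal (s ^ CARD('n))" "emeasure lborel (?Q c) = ennreal (s ^ CARD('n))"
      using assms(1) by (simp_all add: emeasure_lborel_cbox_cart)
    show "E \<bullet> a - d \<le> E \<bullet> x" if "x \<in> ?Q a" for x
      using E[OF that] by (simp add: inner_diff_right)
    show "E \<bullet> x \<le> E \<bullet> c + d" if "x \<in> ?Q c" for x
      using E[OF that] by (simp add: inner_diff_right)
  qed (use assms disj sub dst in auto)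
  also have "(E \<bullet> a - d) - (E \<bullet> c + d) = E \<bullet> (a - c) - 2 * norm E * (real CARD('n) * s)"
    by (simp add: d_def inner_diff_right)
  finally show ?thesis .
qed

section \<open>Choice of the box and comparison of the growth rates\<close>

theorem theorem3p2:
  fixes E :: "real ^ 'n"
  assumes "CARD('n) \<ge> 3" and "E \<noteq> 0"
  shows "(INF \<Omega> \<in> {\<Omega> :: (real ^ 'n) set. compact \<Omega> \<and> convex \<Omega> \<and>
                     emeasure lborel \<Omega> = emeasure lborel (ball (0 :: real ^ 'n) 1)}.
            enn2ereal (hausdorff_measure (CARD('n) - 1) (frontier \<Omega>)) + field_energy E \<Omega>) = -\<infinity>"
proof (rule ereal_bot)
  fix B :: real
  define n where "n = CARD('n)"
  define \<omega> where "\<omega> = unit_ball_vol (real n)"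
  have \<omega>: "0 < \<omega>" by (simp add: \<omega>_def)
  have n: "3 \<le> n" using assms(1) by (simp add: n_def)
  obtain i where "E $ i \<noteq> 0" using assms(2) by (auto simp: vec_eq_iff)
  define e where "e = \<bar>E $ i\<bar>"
  have e: "0 < e" using \<open>E $ i \<noteq> 0\<close> by (simp add: e_def)
  \<comment> \<open>\<open>A\<close> and \<open>G\<close> are the coefficients of the perimeter and
    of the self-energy. \<open>H\<close> collects the field losses: \<open>e * s\<close> because the
    cube corners are only \<open>(K - 1) * s\<close> apart, and the variation of the field over both
    cubes.\<close>
  define A where "A = 2 * real n * unit_ball_vol (real (n - 1)) * real n ^ (n - 1)"
  define G where "G = 2 * (2 ^ n * \<omega> * (2 * real n)\<^sup>2)"
  define H where "H = e + 2 * norm E * real n"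
  have nonneg: "0 \<le> A" "0 \<le> G" "0 \<le> H" using \<omega> e by (simp_all add: A_def G_def H_def)
  \<comment> \<open>From this threshold on, the gain \<open>e * \<omega> * t\<close> exceeds all
    other coefficients by at least \<open>\<bar>B\<bar>\<close>.\<close>
  define T where "T = max 1 ((\<bar>B\<bar> + A * \<omega> + G + H) / (e * \<omega>))"
  obtain K0 :: nat where K0: "\<omega> * T ^ n < real K0" using reals_Archimedean2 by blast
  \<comment> \<open>An integer aspect ratio lets the grid cubes fit the long side; the summand 3
    keeps the end cubes disjoint.\<close>
  define K where "K = K0 + 3"
  \<comment> \<open>The volume constraint \<open>K * s ^ n = \<omega>\<close> with
    \<open>s = 1 / t\<close> forces this value, so \<open>t\<close> is derived from the integer
    \<open>K\<close> and not conversely.\<close>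
  define t where "t = root n (real K / \<omega>)"
  have tn: "t ^ n = real K / \<omega>" using n \<omega> by (simp add: t_def)
  have "T ^ n \<le> t ^ n" using K0 \<omega> by (simp add: tn K_def field_simps)
  then have "T \<le> t" using n \<omega> by (intro power_le_imp_le_base[of T "n - 1" t]) (auto simp: t_def)
  then have t: "1 \<le> t" "(\<bar>B\<bar> + A * \<omega> + G + H) / (e * \<omega>) \<le> t" by (auto simp: T_def)
  define s where "s = 1 / t"
  have s: "0 < s" "s \<le> 1" using t(1) by (auto simp: s_def)
  have K: "real K = \<omega> * t ^ n" using tn \<omega> by simp
  define b :: "real ^ 'n" where "b = (\<chi> j. if j = i then real K * s else s)"
  define a :: "real ^ 'n" where "a = axis i ((real K - 1) * s)"
  let ?Q = "\<lambda>a. cbox a (a + (\<chi> j. s)) :: (real ^ 'n) set"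
  have K3: "3 \<le> real K" by (simp add: K_def)
  have Ks: "s < (real K - 1) * s" "s \<le> real K * s" using K3 s(1) by auto
  have sub: "?Q 0 \<subseteq> cbox 0 b" "?Q a \<subseteq> cbox 0 b"
    using s(1) Ks K3 by (auto simp: subset_interval_cart b_def a_def axis_def algebra_simps)
  have disj: "?Q 0 \<inter> ?Q a = {}"
  proof -
    have False if "x \<in> ?Q 0" "x \<in> ?Q a" for x
    proof -
      have "x $ i \<le> s" using that(1) by (auto simp: mem_box_cart dest: spec[of _ i])
      moreover have "(real K - 1) * s \<le> x $ i"
        using that(2) by (auto simp: mem_box_cart a_def axis_def dest: spec[of _ i])
      ultimately show False using Ks by linarith
    qed
    then show ?thesis by blast
  qed
  have fe: "field_energy E (cbox 0 b) \<le> ereal (G * (s\<^sup>2 / s ^ n) - (e * ((real K - 1) * s) - 2 * norm E * (real n * s)))"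
  proof -
    have Ea: "E \<bullet> a = E $ i * ((real K - 1) * s)"
      by (simp add: a_def inner_axis)
    have G: "2 * (2 ^ n * \<omega> * (2 * real n * s)\<^sup>2 / s ^ n) = G * (s\<^sup>2 / s ^ n)"
      by (simp add: G_def power_mult_distrib)
    show ?thesis
    \<comment> \<open>The positive charge goes to the end with the larger potential: the far cube if
      \<open>E $ i > 0\<close>, the cube at the origin otherwise.\<close>
    proof (cases "E $ i > 0")
      case True
      then show ?thesis
        using field_energy_le_two_cubes[OF s(1) _ _ sub(2,1), of E, folded n_def, folded \<omega>_def, unfolded G] disj n Ea
        by (simp add: e_def Int_commute)
    next
      case False
      then show ?thesis
        using field_energy_le_two_cubes[OF s(1) _ disj sub, of E, folded n_def, folded \<omega>_def, unfolded G] n Ea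
        by (simp add: e_def)
    qed
  qed
  have hm: "hausdorff_measure (CARD('n) - 1) (frontier (cbox 0 b)) \<le> ennreal (A * (real K * s ^ (n - 1)))"
    using hausdorff_measure_frontier_box_le[OF s(1), of K i] K3
    by (simp add: b_def A_def n_def power_mult_distrib mult_ac)
  have "enn2ereal (hausdorff_measure (CARD('n) - 1) (frontier (cbox 0 b))) \<le> ereal (A * (real K * s ^ (n - 1)))"
  proof -
    have "0 \<le> A * (real K * s ^ (n - 1))" using nonneg s by simp
    then show ?thesis using hm by (simp add: less_eq_ennreal.rep_eq)
  qed
  then have "enn2ereal (hausdorff_measure (CARD('n) - 1) (frontier (cbox 0 b))) + field_energy E (cbox 0 b)
    \<le> ereal (A * (real K * s ^ (n - 1))) +
      ereal (G * (s\<^sup>2 / s ^ n) - (e * ((real K - 1) * s) - 2 * norm E * (real n * s)))"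
    using fe by (rule add_mono)
  also have "\<dots> = ereal (A * (real K * s ^ (n - 1)) + G * (s\<^sup>2 / s ^ n) - e * (real K * s) + H * s)"
    by (simp add: H_def algebra_simps)
  also have "\<dots> \<le> ereal B"
  proof -
    obtain m where m: "n = m + 3" using n by (metis add.commute le_iff_add)
    \<comment> \<open>With \<open>K = \<omega> * t ^ n\<close> the perimeter grows like
      \<open>t\<close>, the self-energy like \<open>t ^ (n - 2)\<close> and the field gain like
      \<open>t ^ (n - 1)\<close>.\<close>
    have *: "real K * s ^ (n - 1) = \<omega> * t" "s\<^sup>2 / s ^ n = t ^ (n - 2)" "real K * s = \<omega> * t * t ^ (n - 2)"
      using t(1) by (simp_all add: K m s_def field_simps power_add eval_nat_numeral)
    \<comment> \<open>The second bound is where dimension at least 3 enters: it lets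
      \<open>t ^ (n - 2)\<close> dominate the perimeter as well.\<close>
    have t1: "1 \<le> t ^ (n - 2)" "t \<le> t ^ (n - 2)"
      using t(1) by (simp add: one_le_power, cases "t = 0") (auto simp: m one_le_power)
    have "A * \<omega> * t \<le> A * \<omega> * t ^ (n - 2)" "H * s \<le> H * t ^ (n - 2)"
      using t1 nonneg \<omega> s(2) by (auto intro!: mult_left_mono)
    then have "A * (\<omega> * t) + G * t ^ (n - 2) - e * (\<omega> * t * t ^ (n - 2)) + H * s
      \<le> t ^ (n - 2) * (A * \<omega> + G + H - e * \<omega> * t)"
      by (simp add: algebra_simps)
    \<comment> \<open>By the choice of \<open>T\<close> the bracket is at most
      \<open>- \<bar>B\<bar>\<close>; the factor in front is at least 1 and only helps.\<close>
    also have "\<dots> \<le> t ^ (n - 2) * (- \<bar>B\<bar>)"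
      using t t1 e \<omega> by (intro mult_left_mono) (auto simp: field_simps)
    also have "\<dots> \<le> B" using mult_right_mono[OF t1(1), of "\<bar>B\<bar>"] by simp
    finally show ?thesis unfolding * by simp
  qed
  finally have val: "enn2ereal (hausdorff_measure (CARD('n) - 1) (frontier (cbox 0 b)))
    + field_energy E (cbox 0 b) \<le> ereal B" .
  have vol: "emeasure lborel (cbox 0 b) = emeasure lborel (ball (0 :: real ^ 'n) 1)"
  proof -
    have b0: "0 \<le> b $ j" for j using s by (simp add: b_def)
    have "emeasure lborel (cbox 0 b) = ennreal (\<Prod>j\<in>UNIV. b $ j)"
      using b0 emeasure_lborel_cbox_cart[of 0 b] by simp
    also have "(\<Prod>j\<in>UNIV. b $ j) = (\<Prod>j\<in>UNIV. (if j = i then real K else 1) * s)"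
      by (intro prod.cong) (auto simp: b_def)
    also have "\<dots> = real K * s ^ n"
      by (simp add: prod.distrib n_def)
    also have "\<dots> = \<omega>" using t(1) by (simp add: K s_def power_one_over)
    finally show ?thesis by (simp add: emeasure_ball \<omega>_def n_def)
  qed
  show "(INF \<Omega> \<in> {\<Omega> :: (real ^ 'n) set. compact \<Omega> \<and> convex \<Omega> \<and>
                     emeasure lborel \<Omega> = emeasure lborel (ball (0 :: real ^ 'n) 1)}.
            enn2ereal (hausdorff_measure (CARD('n) - 1) (frontier \<Omega>)) + field_energy E \<Omega>) \<le> ereal B"
    by (rule INF_lower2[of "cbox 0 b"]) (use vol val in \<open>simp_all add: convex_box\<close>)
qed

end
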